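(* Let $E$ be a Banach lattice and let $T,S:E\to E$ be two operators such that $S$ is $\sigma$-weak-uo continuous. Then the sum $T+S$ is uo-demi Dunford–Pettis if and only if $T$ is uo-demi Dunford–Pettis.
   Context: All Banach lattices are real; "operator" means bounded linear map. A net $(x_\alpha)$ in a Banach lattice $E$ is uo-convergent (unbounded order convergent) to $x$, written $x_\alpha\xrightarrow{uo}x$, if $|x_\alpha-x|\wedge y$ converges in order to $0$ for every $y\in E^+$. An operator $T:E\to E$ on a Banach lattice $E$ is uo-demi Dunford–Pettis (unbounded order demi Dunford–Pettis) if for every weakly null sequence $(x_n)$ in $E$ such that $(x_n-T(x_n))$ is uo-convergent to $0$, one has $\|x_n\|\to0$. An operator $S:E\to E$ is $\sigma$-weak-uo continuous if $S(x_n)\xrightarrow{uo}0$ in $E$ for every weakly null sequence $(x_n)$ in $E$. *)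

theory Defs
  imports "HOL-Analysis.Analysis" "HOL-Library.Lattice_Algebras"
begin

class banach_lattice = banach + ordered_real_vector + lattice_ab_group_add_abs +
  assumes norm_mono_abs: "\<bar>x\<bar> \<le> \<bar>y\<bar> \<Longrightarrow> norm x \<le> norm y"

definition directed_on :: "'i set \<Rightarrow> ('i \<times> 'i) set \<Rightarrow> bool" where
  "directed_on I r \<longleftrightarrow>
     I \<noteq> {} \<and> preorder_on I r \<and> (\<forall>a\<in>I. \<forall>b\<in>I. \<exists>c\<in>I. (a, c) \<in> r \<and> (b, c) \<in> r)"

definition net_decreases_to ::
    "'i set \<Rightarrow> ('i \<times> 'i) set \<Rightarrow> ('i \<Rightarrow> 'a::order) \<Rightarrow> 'a \<Rightarrow> bool" where
  "net_decreases_to I r y l \<longleftrightarrow>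
     directed_on I r \<and>
     (\<forall>a\<in>I. \<forall>b\<in>I. (a, b) \<in> r \<longrightarrow> y b \<le> y a) \<and>
     (\<forall>a\<in>I. l \<le> y a) \<and> (\<forall>z. (\<forall>a\<in>I. z \<le> y a) \<longrightarrow> z \<le> l)"

text \<open>
  Order convergence in the sense where the dominating net \<open>y\<close>, decreasing to 0, may have a
  different index set from \<open>f\<close>. HOL cannot quantify over the type of that index set inside a
  definition. Taking it to be a subset of the space itself loses nothing, because a decreasing net
  may be reindexed by its range: see \<open>order_convergesI\<close> below.
\<close>

definition order_converges ::
    "('i \<Rightarrow> 'a::lattice_ab_group_add_abs) \<Rightarrow> 'a \<Rightarrow> 'i filter \<Rightarrow> bool" where
  "order_converges f l F \<longleftrightarrow>
     (\<exists>(I :: 'a set) r y. net_decreases_to I r y 0 \<and>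
        (\<forall>b\<in>I. \<forall>\<^sub>F i in F. \<bar>f i - l\<bar> \<le> y b))"

lemma order_convergesI:
  fixes f :: "'i \<Rightarrow> 'a::lattice_ab_group_add_abs" and J :: "'j set"
  assumes y: "net_decreases_to J s y 0"
    and dom: "\<And>b. b \<in> J \<Longrightarrow> \<forall>\<^sub>F i in F. \<bar>f i - l\<bar> \<le> y b"
  shows "order_converges f l F"
proof -
  let ?r = "{(a, b). a \<in> y ` J \<and> b \<in> y ` J \<and> b \<le> a}"
  have "preorder_on (y ` J) ?r"
    by (auto simp: preorder_on_def refl_on_def intro!: transI)
  moreover have "\<exists>c\<in>y ` J. (a, c) \<in> ?r \<and> (b, c) \<in> ?r" if "a \<in> y ` J" "b \<in> y ` J" for a b
  proof -
    from that obtain j k where jk: "j \<in> J" "a = y j" "k \<in> J" "b = y k" by blast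
    with y obtain m where m: "m \<in> J" "(j, m) \<in> s" "(k, m) \<in> s"
      unfolding net_decreases_to_def directed_on_def by meson
    with y jk have "y m \<le> y j" "y m \<le> y k"
      unfolding net_decreases_to_def by auto
    with jk m show ?thesis by auto
  qed
  ultimately have "net_decreases_to (y ` J) ?r (\<lambda>a. a) 0"
    using y unfolding net_decreases_to_def directed_on_def by auto
  moreover have "\<forall>b\<in>y ` J. \<forall>\<^sub>F i in F. \<bar>f i - l\<bar> \<le> b"
    using dom by auto
  ultimately show ?thesis
    unfolding order_converges_def by blast
qed

definition uo_converges ::
    "('i \<Rightarrow> 'a::lattice_ab_group_add_abs) \<Rightarrow> 'a \<Rightarrow> 'i filter \<Rightarrow> bool" where
  "uo_converges f l F \<longleftrightarrow> (\<forall>y\<ge>0. order_converges (\<lambda>i. inf \<bar>f i - l\<bar> y) 0 F)"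

definition weakly_null :: "(nat \<Rightarrow> 'a::real_normed_vector) \<Rightarrow> bool" where
  "weakly_null x \<longleftrightarrow>
     (\<forall>\<phi> :: 'a \<Rightarrow> real. bounded_linear \<phi> \<longrightarrow> (\<lambda>n. \<phi> (x n)) \<longlonglongrightarrow> 0)"

text \<open>
  The next two notions are meant for operators, i.e. for \<open>T\<close> and \<open>S\<close> satisfying
  \<open>bounded_linear\<close>.
\<close>

definition uo_demi_dunford_pettis :: "('a::banach_lattice \<Rightarrow> 'a) \<Rightarrow> bool" where
  "uo_demi_dunford_pettis T \<longleftrightarrow>
     (\<forall>x. weakly_null x \<and> uo_converges (\<lambda>n. x n - T (x n)) 0 sequentially
        \<longrightarrow> (\<lambda>n. norm (x n)) \<longlonglongrightarrow> 0)"

definition sigma_weak_uo_continuous :: "('a::banach_lattice \<Rightarrow> 'a) \<Rightarrow> bool" where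
  "sigma_weak_uo_continuous S \<longleftrightarrow>
     (\<forall>x. weakly_null x \<longrightarrow> uo_converges (\<lambda>n. S (x n)) 0 sequentially)"

end

theory Submission
  imports Defs
begin

text \<open>
  A sum of uo-null sequences is uo-null, because \<open>inf (a + b) u \<le> inf a u + inf b u\<close> for positive
  \<open>a\<close>, \<open>b\<close>, \<open>u\<close>. So on a weakly null sequence \<open>x\<close> the sequences \<open>x - T x\<close> and \<open>x - (T x + S x)\<close>,
  which differ by the uo-null \<open>S x\<close>, are uo-null simultaneously.
\<close>

text \<open>The two nets have unrelated index sets, so their sum is indexed by pairs under the
  componentwise preorder. A common successor of two pairs is found in each coordinate
  separately.\<close>

lemma net_decreases_to_add:
  fixes y z :: "_ \<Rightarrow> 'a::ordered_ab_group_add"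
  assumes y: "net_decreases_to I r y l" and z: "net_decreases_to J s z m"
  shows "net_decreases_to (I \<times> J)
     {((a, b), (c, d)) |a b c d. (a, c) \<in> r \<and> (b, d) \<in> s} (\<lambda>(a, b). y a + z b) (l + m)"
    (is "net_decreases_to _ ?t _ _")
proof -
  have I: "I \<noteq> {}" "preorder_on I r" and J: "J \<noteq> {}" "preorder_on J s"
    and dirI: "\<And>a b. a \<in> I \<Longrightarrow> b \<in> I \<Longrightarrow> \<exists>c\<in>I. (a, c) \<in> r \<and> (b, c) \<in> r"
    and dirJ: "\<And>a b. a \<in> J \<Longrightarrow> b \<in> J \<Longrightarrow> \<exists>c\<in>J. (a, c) \<in> s \<and> (b, c) \<in> s"
    using y z by (auto simp: net_decreases_to_def directed_on_def)
  have "preorder_on (I \<times> J) ?t"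
    using I(2) J(2) unfolding preorder_on_def refl_on_def trans_def by blast
  moreover have "\<exists>c\<in>I \<times> J. (a, c) \<in> ?t \<and> (b, c) \<in> ?t" if ab: "a \<in> I \<times> J" "b \<in> I \<times> J" for a b
  proof -
    obtain c where "c \<in> I" "(fst a, c) \<in> r" "(fst b, c) \<in> r"
      using dirI[of "fst a" "fst b"] ab by (auto simp: mem_Times_iff)
    moreover obtain d where "d \<in> J" "(snd a, d) \<in> s" "(snd b, d) \<in> s"
      using dirJ[of "snd a" "snd b"] ab by (auto simp: mem_Times_iff)
    ultimately show ?thesis
      by (cases a; cases b) (auto intro!: bexI[of _ "(c, d)"])
  qed
  ultimately have dir: "directed_on (I \<times> J) ?t"
    using I(1) J(1) unfolding directed_on_def by blast
  have inf: "w \<le> l + m" if w: "\<And>a b. a \<in> I \<Longrightarrow> b \<in> J \<Longrightarrow> w \<le> y a + z b" for w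
  proof -
    \<comment> \<open>The infimum is taken one variable at a time: with \<open>b\<close> fixed,
      \<open>w - z b\<close> is a lower bound of \<open>y\<close>, hence at most \<open>l\<close>.
      Then \<open>w - l\<close> is a lower bound of \<open>z\<close>.\<close>
    have "w - l \<le> z b" if b: "b \<in> J" for b
    proof -
      have "\<forall>a\<in>I. w - z b \<le> y a"
        using w b by (simp add: diff_le_eq)
      then have "w - z b \<le> l"
        using y unfolding net_decreases_to_def by blast
      then show ?thesis by (simp add: algebra_simps)
    qed
    then have "w - l \<le> m"
      using z unfolding net_decreases_to_def by blast
    then show ?thesis by (simp add: algebra_simps)
  qed
  show ?thesis
    using y z dir inf unfolding net_decreases_to_def by (auto intro!: add_mono)
qed

text \<open>The sum of the two dominating nets dominates \<open>h\<close>. Asking only for an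
  inequality, not for \<open>h = f + g\<close>, makes this usable for truncations
  \<open>inf _ u\<close>, which are merely subadditive.\<close>

lemma order_converges_add_dominated:
  fixes f g h :: "'i \<Rightarrow> 'a::lattice_ab_group_add_abs"
  assumes f: "order_converges f l F" and g: "order_converges g m F"
    and le: "\<And>i. \<bar>h i - k\<bar> \<le> \<bar>f i - l\<bar> + \<bar>g i - m\<bar>"
  shows "order_converges h k F"
proof -
  obtain I :: "'a set" and r y where y: "net_decreases_to I r y 0"
    and fy: "\<And>b. b \<in> I \<Longrightarrow> \<forall>\<^sub>F i in F. \<bar>f i - l\<bar> \<le> y b"
    using f unfolding order_converges_def by blast
  obtain J :: "'a set" and s z where z: "net_decreases_to J s z 0"
    and gz: "\<And>b. b \<in> J \<Longrightarrow> \<forall>\<^sub>F i in F. \<bar>g i - m\<bar> \<le> z b"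
    using g unfolding order_converges_def by blast
  have "\<forall>\<^sub>F i in F. \<bar>h i - k\<bar> \<le> (case p of (a, b) \<Rightarrow> y a + z b)" if p: "p \<in> I \<times> J" for p
  proof -
    from p obtain a b where ab: "p = (a, b)" "a \<in> I" "b \<in> J" by blast
    from fy[OF ab(2)] gz[OF ab(3)] have "\<forall>\<^sub>F i in F. \<bar>h i - k\<bar> \<le> y a + z b"
      by eventually_elim (meson add_mono le order_trans)
    then show ?thesis by (simp add: ab)
  qed
  \<comment> \<open>Pairs do not form a subset of the space, as the definition demands of an index
    set; \<open>order_convergesI\<close> reindexes the sum net by its range.\<close>
  with net_decreases_to_add[OF y z] show ?thesis
    by (auto intro: order_convergesI)
qed

text \<open>Since addition distributes over \<open>inf\<close>, the right-hand side is the infimum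
  of the four sums \<open>a + b\<close>, \<open>a + u\<close>, \<open>u + b\<close> and
  \<open>u + u\<close>, and positivity puts the left-hand side below each.\<close>

lemma inf_add_le:
  fixes a b u :: "'a::lattice_ab_group_add"
  assumes "0 \<le> a" "0 \<le> b" "0 \<le> u"
  shows "inf (a + b) u \<le> inf a u + inf b u"
proof -
  have "inf (a + b) u \<le> a + u" "inf (a + b) u \<le> u + b" "inf (a + b) u \<le> u + u"
    using assms by (auto intro: le_infI2 add_increasing add_increasing2)
  then show ?thesis
    by (simp add: add_inf_distrib_left add_inf_distrib_right)
qed

lemma uo_converges_add:
  fixes f g :: "'i \<Rightarrow> 'a::lattice_ab_group_add_abs"
  assumes f: "uo_converges f l F" and g: "uo_converges g m F"
  shows "uo_converges (\<lambda>i. f i + g i) (l + m) F"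
  unfolding uo_converges_def
proof (intro allI impI)
  fix u :: 'a
  assume u: "0 \<le> u"
  show "order_converges (\<lambda>i. inf \<bar>f i + g i - (l + m)\<bar> u) 0 F"
  proof (rule order_converges_add_dominated)
    show "order_converges (\<lambda>i. inf \<bar>f i - l\<bar> u) 0 F" "order_converges (\<lambda>i. inf \<bar>g i - m\<bar> u) 0 F"
      using f g u by (auto simp: uo_converges_def)
    fix i
    have "\<bar>f i + g i - (l + m)\<bar> \<le> \<bar>f i - l\<bar> + \<bar>g i - m\<bar>"
      using abs_triangle_ineq[of "f i - l" "g i - m"] by (simp add: algebra_simps)
    then have "inf \<bar>f i + g i - (l + m)\<bar> u \<le> inf (\<bar>f i - l\<bar> + \<bar>g i - m\<bar>) u"
      by (rule inf_mono) simp
    also have "\<dots> \<le> inf \<bar>f i - l\<bar> u + inf \<bar>g i - m\<bar> u"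
      using u by (intro inf_add_le) auto
    \<comment> \<open>The outer bars change nothing: each infimum is of two positive
      elements.\<close>
    finally show "\<bar>inf \<bar>f i + g i - (l + m)\<bar> u - 0\<bar> \<le> \<bar>inf \<bar>f i - l\<bar> u - 0\<bar> + \<bar>inf \<bar>g i - m\<bar> u - 0\<bar>"
      using u by (simp add: abs_of_nonneg)
  qed
qed

lemma uo_converges_minus:
  fixes f :: "'i \<Rightarrow> 'a::lattice_ab_group_add_abs"
  assumes "uo_converges f l F"
  shows "uo_converges (\<lambda>i. - f i) (- l) F"
proof -
  have "\<bar>- f i - - l\<bar> = \<bar>f i - l\<bar>" for i
    using abs_minus_commute[of "f i" l] by simp
  then show ?thesis
    using assms unfolding uo_converges_def by simp
qed

lemma uo_demi_dunford_pettis_add: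
  assumes T: "uo_demi_dunford_pettis T" and S: "sigma_weak_uo_continuous S"
  shows "uo_demi_dunford_pettis (\<lambda>x. T x + S x)"
  unfolding uo_demi_dunford_pettis_def
proof (intro allI impI, elim conjE)
  fix x
  assume x: "weakly_null x" and uo: "uo_converges (\<lambda>n. x n - (T (x n) + S (x n))) 0 sequentially"
  have "uo_converges (\<lambda>n. S (x n)) 0 sequentially"
    using S x by (simp add: sigma_weak_uo_continuous_def)
  \<comment> \<open>Adding \<open>S (x n)\<close> cancels it from
    \<open>x n - (T (x n) + S (x n))\<close>.\<close>
  from uo_converges_add[OF uo this] have "uo_converges (\<lambda>n. x n - T (x n)) 0 sequentially"
    by simp
  with T x show "(\<lambda>n. norm (x n)) \<longlonglongrightarrow> 0"
    by (simp add: uo_demi_dunford_pettis_def)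
qed

theorem proposition4p7:
  fixes T S :: "'a::banach_lattice \<Rightarrow> 'a"
  assumes "bounded_linear T"
    and "bounded_linear S"
    and "sigma_weak_uo_continuous S"
  shows "uo_demi_dunford_pettis (\<lambda>x. T x + S x) \<longleftrightarrow> uo_demi_dunford_pettis T"
proof
  assume TS: "uo_demi_dunford_pettis (\<lambda>x. T x + S x)"
  \<comment> \<open>Writing \<open>T\<close> as \<open>(T + S) + (- S)\<close> makes this direction
    an instance of the other one, with \<open>- S\<close> as the perturbation.\<close>
  have "sigma_weak_uo_continuous (\<lambda>x. - S x)"
    using assms(3) uo_converges_minus[where l = 0] by (fastforce simp: sigma_weak_uo_continuous_def)
  from uo_demi_dunford_pettis_add[OF TS this] show "uo_demi_dunford_pettis T"
    by simp
next
  assume "uo_demi_dunford_pettis T"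
  then show "uo_demi_dunford_pettis (\<lambda>x. T x + S x)"
    using assms(3) by (rule uo_demi_dunford_pettis_add)
qed

end
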